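(* Let $M$ be a tame refinement monoid. If $M$ is stably finite, then $M$ is cancellative.
   Context: All monoids are commutative, written additively, and homomorphisms are monoid homomorphisms. $M$ is a refinement monoid if whenever $x_1+x_2=y_1+y_2$ in $M$, there exist $z_{ij}\in M$ ($i,j=1,2$) with $x_i=z_{i1}+z_{i2}$ for $i=1,2$ and $y_j=z_{1j}+z_{2j}$ for $j=1,2$. A refinement monoid is tame if it is an inductive (directed) limit, in the category of commutative monoids, of an inductive system of finitely generated refinement monoids. $M$ is stably finite if $x+y=x$ implies $y=0$ for all $x,y\in M$. $M$ is cancellative if $x+y=x+z$ implies $y=z$ for all $x,y,z\in M$. *)

theory Defs
  imports "HOL-Algebra.Group"
begin

(* Commutative monoids are the library's comm_monoid, so the additive notation x + y, 0 of the
   source is written x \<otimes> y, \<one>. *)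

(* For monoids, membership in hom does not imply preservation of the unit. *)
definition monoid_homs :: "('a, 'm) monoid_scheme \<Rightarrow> ('b, 'n) monoid_scheme \<Rightarrow> ('a \<Rightarrow> 'b) set" where
  "monoid_homs M N = {h \<in> hom M N. h \<one>\<^bsub>M\<^esub> = \<one>\<^bsub>N\<^esub>}"

definition finitely_generated_monoid :: "('a, 'm) monoid_scheme \<Rightarrow> bool" where
  "finitely_generated_monoid M \<longleftrightarrow>
     (\<exists>S. finite S \<and> S \<subseteq> carrier M \<and> (\<forall>H. submonoid H M \<and> S \<subseteq> H \<longrightarrow> H = carrier M))"

locale refinement_monoid = comm_monoid +
  assumes refinement:
    "\<lbrakk>x\<^sub>1 \<in> carrier G; x\<^sub>2 \<in> carrier G; y\<^sub>1 \<in> carrier G; y\<^sub>2 \<in> carrier G; x\<^sub>1 \<otimes> x\<^sub>2 = y\<^sub>1 \<otimes> y\<^sub>2\<rbrakk> \<Longrightarrow>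
       \<exists>z\<^sub>1\<^sub>1 \<in> carrier G. \<exists>z\<^sub>1\<^sub>2 \<in> carrier G. \<exists>z\<^sub>2\<^sub>1 \<in> carrier G. \<exists>z\<^sub>2\<^sub>2 \<in> carrier G.
         x\<^sub>1 = z\<^sub>1\<^sub>1 \<otimes> z\<^sub>1\<^sub>2 \<and> x\<^sub>2 = z\<^sub>2\<^sub>1 \<otimes> z\<^sub>2\<^sub>2 \<and> y\<^sub>1 = z\<^sub>1\<^sub>1 \<otimes> z\<^sub>2\<^sub>1 \<and> y\<^sub>2 = z\<^sub>1\<^sub>2 \<otimes> z\<^sub>2\<^sub>2"

definition stably_finite_monoid :: "('a, 'm) monoid_scheme \<Rightarrow> bool" where
  "stably_finite_monoid M \<longleftrightarrow>
     (\<forall>x \<in> carrier M. \<forall>y \<in> carrier M. x \<otimes>\<^bsub>M\<^esub> y = x \<longrightarrow> y = \<one>\<^bsub>M\<^esub>)"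

definition cancellative_monoid :: "('a, 'm) monoid_scheme \<Rightarrow> bool" where
  "cancellative_monoid M \<longleftrightarrow>
     (\<forall>x \<in> carrier M. \<forall>y \<in> carrier M. \<forall>z \<in> carrier M. x \<otimes>\<^bsub>M\<^esub> y = x \<otimes>\<^bsub>M\<^esub> z \<longrightarrow> y = z)"

locale inductive_system =
  fixes I :: "'i set" and le :: "'i \<Rightarrow> 'i \<Rightarrow> bool"
    and D :: "'i \<Rightarrow> 'b monoid" and \<phi> :: "'i \<Rightarrow> 'i \<Rightarrow> 'b \<Rightarrow> 'b"
  assumes nonempty: "I \<noteq> {}"
    and le_refl: "i \<in> I \<Longrightarrow> le i i"
    and le_trans: "\<lbrakk>i \<in> I; j \<in> I; k \<in> I; le i j; le j k\<rbrakk> \<Longrightarrow> le i k"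
    and directed: "\<lbrakk>i \<in> I; j \<in> I\<rbrakk> \<Longrightarrow> \<exists>k \<in> I. le i k \<and> le j k"
    and comm_monoid_D: "i \<in> I \<Longrightarrow> comm_monoid (D i)"
    and \<phi>_hom: "\<lbrakk>i \<in> I; j \<in> I; le i j\<rbrakk> \<Longrightarrow> \<phi> i j \<in> monoid_homs (D i) (D j)"
    and \<phi>_id: "\<lbrakk>i \<in> I; x \<in> carrier (D i)\<rbrakk> \<Longrightarrow> \<phi> i i x = x"
    and \<phi>_comp: "\<lbrakk>i \<in> I; j \<in> I; k \<in> I; le i j; le j k; x \<in> carrier (D i)\<rbrakk> \<Longrightarrow>
                   \<phi> j k (\<phi> i j x) = \<phi> i k x"
begin

(* The inductive limit in the category of commutative monoids, as the usual quotient of the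
   disjoint union; its universal property, for targets of any type, is proved below. *)

definition lim_rel :: "(('i \<times> 'b) \<times> ('i \<times> 'b)) set" where
  "lim_rel = {((i, x), (j, y)). i \<in> I \<and> j \<in> I \<and> x \<in> carrier (D i) \<and> y \<in> carrier (D j) \<and>
                (\<exists>k \<in> I. le i k \<and> le j k \<and> \<phi> i k x = \<phi> j k y)}"

definition lim_map :: "'i \<Rightarrow> 'b \<Rightarrow> ('i \<times> 'b) set" where
  "lim_map i x = lim_rel `` {(i, x)}"

(* Both unions are over families of equal classes (see lim_mult_eq and lim_one_eq). *)
definition inductive_limit :: "('i \<times> 'b) set monoid" where
  "inductive_limit =
     \<lparr>carrier = (SIGMA i:I. carrier (D i)) // lim_rel,
      monoid.mult = (\<lambda>X Y. \<Union>{lim_map k (\<phi> i k x \<otimes>\<^bsub>D k\<^esub> \<phi> j k y) | i j k x y.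
                        (i, x) \<in> X \<and> (j, y) \<in> Y \<and> k \<in> I \<and> le i k \<and> le j k}),
      one = (\<Union>i \<in> I. lim_map i \<one>\<^bsub>D i\<^esub>)\<rparr>"

lemma \<phi>_closed: "\<lbrakk>i \<in> I; j \<in> I; le i j; x \<in> carrier (D i)\<rbrakk> \<Longrightarrow> \<phi> i j x \<in> carrier (D j)"
  using \<phi>_hom[of i j] by (auto simp: monoid_homs_def hom_def)

lemma \<phi>_mult: "\<lbrakk>i \<in> I; j \<in> I; le i j; x \<in> carrier (D i); y \<in> carrier (D i)\<rbrakk> \<Longrightarrow>
    \<phi> i j (x \<otimes>\<^bsub>D i\<^esub> y) = \<phi> i j x \<otimes>\<^bsub>D j\<^esub> \<phi> i j y"
  using \<phi>_hom[of i j] by (auto simp: monoid_homs_def hom_def)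

lemma \<phi>_one: "\<lbrakk>i \<in> I; j \<in> I; le i j\<rbrakk> \<Longrightarrow> \<phi> i j \<one>\<^bsub>D i\<^esub> = \<one>\<^bsub>D j\<^esub>"
  using \<phi>_hom[of i j] by (auto simp: monoid_homs_def)

lemma D_mult_closed: "\<lbrakk>i \<in> I; x \<in> carrier (D i); y \<in> carrier (D i)\<rbrakk> \<Longrightarrow> x \<otimes>\<^bsub>D i\<^esub> y \<in> carrier (D i)"
  using comm_monoid_D[of i] by (simp add: comm_monoid_def monoid.m_closed)

lemma D_one_closed: "i \<in> I \<Longrightarrow> \<one>\<^bsub>D i\<^esub> \<in> carrier (D i)"
  using comm_monoid_D[of i] by (simp add: comm_monoid_def monoid.one_closed)

lemma lim_relI:
  "\<lbrakk>i \<in> I; j \<in> I; k \<in> I; x \<in> carrier (D i); y \<in> carrier (D j); le i k; le j k; \<phi> i k x = \<phi> j k y\<rbrakk>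
     \<Longrightarrow> ((i, x), (j, y)) \<in> lim_rel"
  unfolding lim_rel_def by blast

lemma equiv_lim_rel: "equiv (SIGMA i:I. carrier (D i)) lim_rel"
proof (rule equivI)
  show "lim_rel \<subseteq> (SIGMA i:I. carrier (D i)) \<times> (SIGMA i:I. carrier (D i))"
    by (auto simp: lim_rel_def)
  show "refl_on (SIGMA i:I. carrier (D i)) lim_rel"
    by (auto simp: refl_on_def intro!: lim_relI le_refl)
  show "sym lim_rel"
    unfolding sym_def lim_rel_def by fastforce
  show "trans lim_rel"
  proof (rule transI)
    fix a b c assume ab: "(a, b) \<in> lim_rel" and bc: "(b, c) \<in> lim_rel"
    obtain i x j y k z where abc: "a = (i, x)" "b = (j, y)" "c = (k, z)"
      by (metis surj_pair)
    obtain l where l: "i \<in> I" "j \<in> I" "x \<in> carrier (D i)" "y \<in> carrier (D j)"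
        "l \<in> I" "le i l" "le j l" "\<phi> i l x = \<phi> j l y"
      using ab abc by (auto simp: lim_rel_def)
    obtain m where m: "k \<in> I" "z \<in> carrier (D k)" "m \<in> I" "le j m" "le k m" "\<phi> j m y = \<phi> k m z"
      using bc abc by (auto simp: lim_rel_def)
    obtain n where n: "n \<in> I" "le l n" "le m n"
      using directed l m by blast
    have "\<phi> i n x = \<phi> l n (\<phi> i l x)" using l n \<phi>_comp by metis
    also have "\<dots> = \<phi> j n y" using l n \<phi>_comp by metis
    also have "\<dots> = \<phi> m n (\<phi> j m y)" using l m n \<phi>_comp by metis
    also have "\<dots> = \<phi> k n z" using m n \<phi>_comp by metis
    finally have "\<phi> i n x = \<phi> k n z" .
    moreover have "le i n" "le k n" using l m n le_trans by blast+
    ultimately show "(a, c) \<in> lim_rel"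
      using l m n abc lim_relI by blast
  qed
qed

lemma lim_map_eq_iff:
  assumes "i \<in> I" "j \<in> I" "x \<in> carrier (D i)" "y \<in> carrier (D j)"
  shows "lim_map i x = lim_map j y \<longleftrightarrow> (\<exists>k \<in> I. le i k \<and> le j k \<and> \<phi> i k x = \<phi> j k y)"
  using assms eq_equiv_class_iff[OF equiv_lim_rel, of "(i, x)" "(j, y)"]
  by (auto simp: lim_map_def lim_rel_def)

lemma lim_map_compat:
  assumes "i \<in> I" "j \<in> I" "le i j" "x \<in> carrier (D i)"
  shows "lim_map j (\<phi> i j x) = lim_map i x"
proof -
  have "\<phi> j j (\<phi> i j x) = \<phi> i j x" using assms by (simp add: \<phi>_id \<phi>_closed)
  then show ?thesis
    using assms le_refl[of j] by (subst lim_map_eq_iff) (auto simp: \<phi>_closed)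
qed

lemma carrier_lim: "carrier inductive_limit = (\<Union>i \<in> I. lim_map i ` carrier (D i))"
  by (auto simp: inductive_limit_def lim_map_def quotient_def)

lemma mem_lim_map: "(j, y) \<in> lim_map i x \<longleftrightarrow>
    i \<in> I \<and> j \<in> I \<and> x \<in> carrier (D i) \<and> y \<in> carrier (D j) \<and> lim_map i x = lim_map j y"
proof (cases "i \<in> I \<and> j \<in> I \<and> x \<in> carrier (D i) \<and> y \<in> carrier (D j)")
  case True
  then have "lim_map i x = lim_map j y \<longleftrightarrow> (\<exists>k \<in> I. le i k \<and> le j k \<and> \<phi> i k x = \<phi> j k y)"
    by (simp only: lim_map_eq_iff)
  with True show ?thesis
    by (simp only: lim_map_def lim_rel_def Image_singleton_iff mem_Collect_eq case_prod_conv)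
qed (auto simp: lim_map_def lim_rel_def)

lemma lim_map_mult_cong:
  assumes "i \<in> I" "j \<in> I" "x \<in> carrier (D i)" "x' \<in> carrier (D i)" "y \<in> carrier (D j)" "y' \<in> carrier (D j)"
    and eq: "lim_map i x = lim_map j y" "lim_map i x' = lim_map j y'"
  shows "lim_map i (x \<otimes>\<^bsub>D i\<^esub> x') = lim_map j (y \<otimes>\<^bsub>D j\<^esub> y')"
proof -
  obtain k where k: "k \<in> I" "le i k" "le j k" "\<phi> i k x = \<phi> j k y"
    using eq assms by (auto simp: lim_map_eq_iff)
  obtain l where l: "l \<in> I" "le i l" "le j l" "\<phi> i l x' = \<phi> j l y'"
    using eq assms by (auto simp: lim_map_eq_iff)
  obtain m where m: "m \<in> I" "le k m" "le l m" using directed k l by blast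
  have le: "le i m" "le j m" using assms k l m le_trans by blast+
  have "\<phi> i m x = \<phi> j m y" using assms k m \<phi>_comp by metis
  moreover have "\<phi> i m x' = \<phi> j m y'" using assms l m \<phi>_comp by metis
  ultimately have "\<phi> i m (x \<otimes>\<^bsub>D i\<^esub> x') = \<phi> j m (y \<otimes>\<^bsub>D j\<^esub> y')"
    using assms m le by (simp add: \<phi>_mult)
  then show ?thesis
    using assms m le by (subst lim_map_eq_iff) (auto simp: D_mult_closed)
qed

lemma lim_mult_eq:
  assumes "i \<in> I" "j \<in> I" "k \<in> I" "le i k" "le j k" "x \<in> carrier (D i)" "y \<in> carrier (D j)"
  shows "lim_map i x \<otimes>\<^bsub>inductive_limit\<^esub> lim_map j y = lim_map k (\<phi> i k x \<otimes>\<^bsub>D k\<^esub> \<phi> j k y)"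
proof -
  let ?S = "{lim_map k' (\<phi> i' k' x' \<otimes>\<^bsub>D k'\<^esub> \<phi> j' k' y') | i' j' k' x' y'.
        (i', x') \<in> lim_map i x \<and> (j', y') \<in> lim_map j y \<and> k' \<in> I \<and> le i' k' \<and> le j' k'}"
  let ?c = "lim_map k (\<phi> i k x \<otimes>\<^bsub>D k\<^esub> \<phi> j k y)"
  have eq: "lim_map k' (\<phi> i' k' x' \<otimes>\<^bsub>D k'\<^esub> \<phi> j' k' y') = ?c"
    if "(i', x') \<in> lim_map i x" "(j', y') \<in> lim_map j y" "k' \<in> I" "le i' k'" "le j' k'"
    for i' j' k' x' y'
  proof -
    have x': "i' \<in> I" "x' \<in> carrier (D i')" "lim_map i x = lim_map i' x'"
      and y': "j' \<in> I" "y' \<in> carrier (D j')" "lim_map j y = lim_map j' y'"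
      using that(1,2) unfolding mem_lim_map by blast+
    have "lim_map k' (\<phi> i' k' x') = lim_map k (\<phi> i k x)"
      using lim_map_compat[OF x'(1) that(3,4) x'(2)] lim_map_compat[OF assms(1,3,4,6)] x'(3)
      by (simp only:)
    moreover have "lim_map k' (\<phi> j' k' y') = lim_map k (\<phi> j k y)"
      using lim_map_compat[OF y'(1) that(3,5) y'(2)] lim_map_compat[OF assms(2,3,5,7)] y'(3)
      by (simp only:)
    ultimately show ?thesis
      using x'(1,2) y'(1,2) that(3-5) assms by (intro lim_map_mult_cong \<phi>_closed)
  qed
  have "?S \<subseteq> {?c}"
  proof
    fix Z assume "Z \<in> ?S"
    then obtain i' j' k' x' y' where Z: "Z = lim_map k' (\<phi> i' k' x' \<otimes>\<^bsub>D k'\<^esub> \<phi> j' k' y')"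
      and *: "(i', x') \<in> lim_map i x" "(j', y') \<in> lim_map j y" "k' \<in> I" "le i' k'" "le j' k'"
      by blast
    show "Z \<in> {?c}" unfolding Z eq[OF *] by (rule singletonI)
  qed
  moreover have "?c \<in> ?S"
  proof -
    have "(i, x) \<in> lim_map i x" "(j, y) \<in> lim_map j y"
      using assms by (simp_all only: mem_lim_map simp_thms)
    then show ?thesis using assms(3-5) unfolding mem_Collect_eq by (intro exI conjI) (rule refl)
  qed
  ultimately have "?S = {?c}" by (intro subset_antisym) (simp_all only: insert_subset empty_subsetI simp_thms)
  then have "\<Union>?S = \<Union>{?c}" by (rule arg_cong)
  also have "\<dots> = ?c" by (rule cSup_singleton)
  finally show ?thesis unfolding inductive_limit_def monoid.select_convs .
qed

lemma lim_mult_same: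
  assumes "i \<in> I" "x \<in> carrier (D i)" "y \<in> carrier (D i)"
  shows "lim_map i x \<otimes>\<^bsub>inductive_limit\<^esub> lim_map i y = lim_map i (x \<otimes>\<^bsub>D i\<^esub> y)"
  using lim_mult_eq[of i i i x y] assms by (simp add: le_refl \<phi>_id)

lemma lim_one_eq:
  assumes "i \<in> I"
  shows "\<one>\<^bsub>inductive_limit\<^esub> = lim_map i \<one>\<^bsub>D i\<^esub>"
proof -
  have "lim_map j \<one>\<^bsub>D j\<^esub> = lim_map i \<one>\<^bsub>D i\<^esub>" if "j \<in> I" for j
  proof -
    obtain k where "k \<in> I" "le i k" "le j k" using directed assms \<open>j \<in> I\<close> by blast
    then show ?thesis
      using assms that by (subst lim_map_eq_iff) (auto simp: D_one_closed \<phi>_one)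
  qed
  then have "(\<Union>j \<in> I. lim_map j \<one>\<^bsub>D j\<^esub>) = (\<Union>j \<in> I. lim_map i \<one>\<^bsub>D i\<^esub>)"
    by (rule SUP_cong[OF refl])
  also have "\<dots> = lim_map i \<one>\<^bsub>D i\<^esub>" using assms by auto
  finally show ?thesis by (simp add: inductive_limit_def)
qed

lemma lim_common:
  assumes "X \<in> carrier inductive_limit" "Y \<in> carrier inductive_limit"
  obtains k x y where "k \<in> I" "x \<in> carrier (D k)" "y \<in> carrier (D k)"
    "X = lim_map k x" "Y = lim_map k y"
proof -
  obtain i x j y where *: "i \<in> I" "x \<in> carrier (D i)" "X = lim_map i x"
      "j \<in> I" "y \<in> carrier (D j)" "Y = lim_map j y"
    using assms by (auto simp: carrier_lim)
  obtain k where "k \<in> I" "le i k" "le j k" using directed * by blast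
  then show thesis using * that[of k "\<phi> i k x" "\<phi> j k y"] by (simp add: \<phi>_closed lim_map_compat)
qed

lemma lim_map_hom: "i \<in> I \<Longrightarrow> lim_map i \<in> monoid_homs (D i) inductive_limit"
  using lim_one_eq[of i] by (auto simp: monoid_homs_def hom_def carrier_lim lim_mult_same)

lemma comm_monoid_inductive_limit: "comm_monoid inductive_limit"
proof (rule comm_monoidI)
  fix X Y Z
  assume X: "X \<in> carrier inductive_limit" and Y: "Y \<in> carrier inductive_limit"
  obtain k x y where k: "k \<in> I" "x \<in> carrier (D k)" "y \<in> carrier (D k)"
      "X = lim_map k x" "Y = lim_map k y"
    using lim_common[OF X Y] by blast
  interpret Dk: comm_monoid "D k" using k comm_monoid_D by blast
  show "X \<otimes>\<^bsub>inductive_limit\<^esub> Y \<in> carrier inductive_limit"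
    using k by (auto simp: lim_mult_same carrier_lim)
  show "X \<otimes>\<^bsub>inductive_limit\<^esub> Y = Y \<otimes>\<^bsub>inductive_limit\<^esub> X"
    using k by (simp add: lim_mult_same Dk.m_comm)
  show "\<one>\<^bsub>inductive_limit\<^esub> \<otimes>\<^bsub>inductive_limit\<^esub> X = X"
    using k lim_one_eq[of k] by (simp add: lim_mult_same)
  assume Z: "Z \<in> carrier inductive_limit"
  obtain l z where l: "l \<in> I" "z \<in> carrier (D l)" "Z = lim_map l z"
    using Z by (auto simp: carrier_lim)
  obtain m where m: "m \<in> I" "le k m" "le l m" using directed k l by blast
  interpret Dm: comm_monoid "D m" using m comm_monoid_D by blast
  define x' y' z' where "x' = \<phi> k m x" and "y' = \<phi> k m y" and "z' = \<phi> l m z"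
  have "X = lim_map m x'" "Y = lim_map m y'" "Z = lim_map m z'"
      "x' \<in> carrier (D m)" "y' \<in> carrier (D m)" "z' \<in> carrier (D m)"
    using k l m by (simp_all add: x'_def y'_def z'_def lim_map_compat \<phi>_closed)
  then show "X \<otimes>\<^bsub>inductive_limit\<^esub> Y \<otimes>\<^bsub>inductive_limit\<^esub> Z
      = X \<otimes>\<^bsub>inductive_limit\<^esub> (Y \<otimes>\<^bsub>inductive_limit\<^esub> Z)"
    using m by (simp add: lim_mult_same Dm.m_assoc)
next
  show "\<one>\<^bsub>inductive_limit\<^esub> \<in> carrier inductive_limit"
    proof -
    obtain i where "i \<in> I" using nonempty by blast
    then show ?thesis using D_one_closed lim_one_eq[of i] by (auto simp: carrier_lim)
  qed
qed

theorem inductive_limit_universal: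
  fixes N :: "('c, 'n) monoid_scheme"
  assumes N: "comm_monoid N"
    and f: "\<And>i. i \<in> I \<Longrightarrow> f i \<in> monoid_homs (D i) N"
    and compat: "\<And>i j x. \<lbrakk>i \<in> I; j \<in> I; le i j; x \<in> carrier (D i)\<rbrakk> \<Longrightarrow> f j (\<phi> i j x) = f i x"
  shows "\<exists>u \<in> monoid_homs inductive_limit N.
           (\<forall>i \<in> I. \<forall>x \<in> carrier (D i). u (lim_map i x) = f i x) \<and>
           (\<forall>v \<in> monoid_homs inductive_limit N.
              (\<forall>i \<in> I. \<forall>x \<in> carrier (D i). v (lim_map i x) = f i x) \<longrightarrow>
              (\<forall>X \<in> carrier inductive_limit. v X = u X))"
proof -
  define u where "u X = (let (i, x) = (SOME p. p \<in> X) in f i x)" for X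
  have u: "u (lim_map i x) = f i x" if ix: "i \<in> I" "x \<in> carrier (D i)" for i x
  proof -
    obtain j y where jy: "(SOME p. p \<in> lim_map i x) = (j, y)" by fastforce
    have "(i, x) \<in> lim_map i x" using that by (simp add: mem_lim_map)
    then have "(j, y) \<in> lim_map i x" using jy someI[of "\<lambda>p. p \<in> lim_map i x"] by metis
    then have j: "j \<in> I" "y \<in> carrier (D j)" "lim_map i x = lim_map j y"
      by (auto simp: mem_lim_map)
    then obtain k where "k \<in> I" "le i k" "le j k" "\<phi> i k x = \<phi> j k y"
      using lim_map_eq_iff[OF ix(1) j(1) ix(2) j(2)] by blast
    then have "f i x = f j y" using compat that j by metis
    then show ?thesis by (simp add: u_def jy)
  qed
  have f_mem: "f i x \<in> carrier N" if "i \<in> I" "x \<in> carrier (D i)" for i x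
    using f that by (auto simp: monoid_homs_def hom_def)
  have f_mult: "f i (x \<otimes>\<^bsub>D i\<^esub> y) = f i x \<otimes>\<^bsub>N\<^esub> f i y"
    if "i \<in> I" "x \<in> carrier (D i)" "y \<in> carrier (D i)" for i x y
    using f that by (auto simp: monoid_homs_def hom_def)
  have "u \<in> hom inductive_limit N"
  proof (rule homI)
    fix X Y assume X: "X \<in> carrier inductive_limit" and Y: "Y \<in> carrier inductive_limit"
    obtain k x y where k: "k \<in> I" "x \<in> carrier (D k)" "y \<in> carrier (D k)"
        "X = lim_map k x" "Y = lim_map k y"
      using lim_common[OF X Y] by blast
    then show "u X \<in> carrier N" by (simp add: u f_mem)
    show "u (X \<otimes>\<^bsub>inductive_limit\<^esub> Y) = u X \<otimes>\<^bsub>N\<^esub> u Y"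
      using k by (simp add: u lim_mult_same D_mult_closed f_mult)
  qed
  moreover have "u \<one>\<^bsub>inductive_limit\<^esub> = \<one>\<^bsub>N\<^esub>"
  proof -
    obtain i where "i \<in> I" using nonempty by blast
    then show ?thesis using f[of i] by (simp add: lim_one_eq[of i] u D_one_closed monoid_homs_def)
  qed
  ultimately have "u \<in> monoid_homs inductive_limit N" by (simp add: monoid_homs_def)
  then show ?thesis by (rule bexI[rotated]) (auto simp: u carrier_lim)
qed

end

(* HOL cannot quantify over types inside a definition, so the types 'i of indices and 'b of
   elements of the monoids in the system are parameters. *)
definition tame_refinement_monoid ::
  "'i itself \<Rightarrow> 'b itself \<Rightarrow> ('a, 'm) monoid_scheme \<Rightarrow> bool" where
  "tame_refinement_monoid TI TB M \<longleftrightarrow>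
     refinement_monoid M \<and>
     (\<exists>(I :: 'i set) le (D :: 'i \<Rightarrow> 'b monoid) \<phi>.
        inductive_system I le D \<phi> \<and>
        (\<forall>i \<in> I. refinement_monoid (D i) \<and> finitely_generated_monoid (D i)) \<and>
        M \<cong> inductive_system.inductive_limit I le D \<phi>)"

end

theory Submission
  imports Complex_Main Defs "HOL-Algebra.Divisibility"
begin

text \<open>
  Suppose \<open>a + b = a + c\<close> in \<open>M\<close>. Since \<open>M\<close> is a limit, the equation already holds in a finitely
  generated refinement monoid \<open>D\<close> of the system, and \<open>b\<close> and \<open>c\<close> must be shown to have the same
  image under \<open>\<phi> : D \<rightarrow> M\<close>. (\<open>D\<close> itself need be neither stably finite nor cancellative.)

  Refining the equation in \<open>D\<close> gives \<open>a = d + p = d + q\<close>, \<open>b = q + r\<close> and \<open>c = p + r\<close>, so it is enough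
  to show \<open>\<phi> p = \<phi> q\<close>. As \<open>d + p = d + q\<close>, the triple \<open>(d, p, q)\<close> poses the same problem
  as \<open>(a, b, c)\<close>, with \<open>d \<le> a\<close> in the algebraic preorder. The refinement can be repeated as long as
  this makes \<open>d\<close> strictly smaller than \<open>a\<close>, and that must come to an end: by Dickson's lemma the
  algebraic preorder of a finitely generated commutative monoid is a well-quasi-order, hence its
  strict part is well-founded (\<open>wf_properfactor\<close>). At the end \<open>d = a + s\<close> for some \<open>s\<close>, so that
  \<open>a + (s + p) = a = a + (s + q)\<close>. Stable finiteness of \<open>M\<close> turns this into
  \<open>\<phi> s + \<phi> p = 0 = \<phi> s + \<phi> q\<close>, and \<open>\<phi> p = \<phi> q\<close> because inverses are unique
  (\<open>refinement_hom_cancel\<close>).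

  In the multiplicative notation of the code, the algebraic preorder is divisibility.
\<close>

section \<open>Divisibility in finitely generated commutative monoids\<close>

text \<open>
  This is the well-quasi-order property of divisibility on \<open>A\<close>, in the form that survives the passage
  to products: instead of one pair \<open>i < j\<close> with \<open>f i\<close> dividing \<open>f j\<close>, a whole subsequence is asked
  for, from which a further subsequence can then be chosen for the second factor.
\<close>

definition divides_wqo :: "('a, 'm) monoid_scheme \<Rightarrow> 'a set \<Rightarrow> bool" where
  "divides_wqo G A \<longleftrightarrow>
     (\<forall>f :: nat \<Rightarrow> 'a. range f \<subseteq> A \<longrightarrow>
        (\<exists>r :: nat \<Rightarrow> nat. strict_mono r \<and> (\<forall>i j. i \<le> j \<longrightarrow> f (r i) divides\<^bsub>G\<^esub> f (r j))))"

text \<open>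
  A monotone subsequence always exists; if it is decreasing, it is constant from the point on where
  it attains its least value.
\<close>

lemma nat_mono_subseq:
  fixes e :: "nat \<Rightarrow> nat"
  shows "\<exists>r :: nat \<Rightarrow> nat. strict_mono r \<and> mono (\<lambda>i. e (r i))"
proof -
  obtain s :: "nat \<Rightarrow> nat" where s: "strict_mono s" "monoseq (\<lambda>n. e (s n))"
    using seq_monosub[of e] by blast
  obtain N where N: "\<And>n. e (s N) \<le> e (s n)"
    using ex_has_least_nat[of "\<lambda>_. True" 0 "\<lambda>n. e (s n)"] by blast
  have "e (s (N + i)) \<le> e (s (N + j))" if "i \<le> j" for i j
  proof -
    have "N \<le> N + i" "N + i \<le> N + j" using that by simp_all
    then have "e (s (N + i)) \<le> e (s (N + j)) \<or> e (s (N + i)) \<le> e (s N)"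
      using s(2) unfolding monoseq_def by blast
    then show ?thesis using N[of "N + j"] by linarith
  qed
  moreover have "strict_mono (\<lambda>n. s (N + n))"
    using s(1) by (simp add: strict_mono_def)
  ultimately have "strict_mono (\<lambda>n. s (N + n)) \<and> mono (\<lambda>n. e (s (N + n)))" by (simp add: mono_def)
  then show ?thesis by (rule exI[of _ "\<lambda>n. s (N + n)"])
qed

context comm_monoid
begin

lemma divides_mult_mono:
  assumes "a divides b" "c divides d" "a \<in> carrier G" "c \<in> carrier G"
  shows "a \<otimes> c divides b \<otimes> d"
proof -
  obtain x y where x: "x \<in> carrier G" "b = a \<otimes> x" and y: "y \<in> carrier G" "d = c \<otimes> y"
    using assms(1,2) unfolding factor_def by blast
  have "b \<otimes> d = (a \<otimes> c) \<otimes> (x \<otimes> y)"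
    using x y assms(3,4) by (simp add: m_ac)
  then show ?thesis using x y by (intro dividesI) auto
qed

lemma nat_pow_divides_mono:
  assumes "s \<in> carrier G" "m \<le> n"
  shows "s [^] (m :: nat) divides s [^] (n :: nat)"
proof (rule dividesI)
  show "s [^] n = s [^] m \<otimes> s [^] (n - m)"
    using assms by (simp add: nat_pow_mult)
qed (use assms in simp)

lemma divides_wqo_powers_mult:
  assumes s: "s \<in> carrier G" and H: "H \<subseteq> carrier G" "divides_wqo G H"
  shows "divides_wqo G {s [^] (n :: nat) \<otimes> h | n h. h \<in> H}"
  unfolding divides_wqo_def
proof (intro allI impI)
  fix f :: "nat \<Rightarrow> 'a"
  assume "range f \<subseteq> {s [^] (n :: nat) \<otimes> h | n h. h \<in> H}"
  then have "\<forall>i. \<exists>n. \<exists>h \<in> H. f i = s [^] (n :: nat) \<otimes> h" by blast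
  from choice[OF this] obtain e :: "nat \<Rightarrow> nat" where "\<forall>i. \<exists>h \<in> H. f i = s [^] e i \<otimes> h" ..
  then have "\<forall>i. \<exists>h. h \<in> H \<and> f i = s [^] e i \<otimes> h" by blast
  from choice[OF this] obtain g where g: "\<And>i. g i \<in> H" and f: "\<And>i. f i = s [^] e i \<otimes> g i"
    by blast
  obtain r :: "nat \<Rightarrow> nat" where r: "strict_mono r" "mono (\<lambda>i. e (r i))"
    using nat_mono_subseq[of e] by blast
  have "range (g \<circ> r) \<subseteq> H" using g by auto
  then have "\<exists>t :: nat \<Rightarrow> nat. strict_mono t \<and> (\<forall>i j. i \<le> j \<longrightarrow> (g \<circ> r) (t i) divides (g \<circ> r) (t j))"
    using H(2) unfolding divides_wqo_def by blast
  then obtain t :: "nat \<Rightarrow> nat" where t: "strict_mono t"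
    "\<And>i j. i \<le> j \<Longrightarrow> g (r (t i)) divides g (r (t j))"
    by auto
  have "f (r (t i)) divides f (r (t j))" if "i \<le> j" for i j
    unfolding f
  proof (rule divides_mult_mono)
    show "s [^] e (r (t i)) divides s [^] e (r (t j))"
    proof (rule nat_pow_divides_mono[OF s])
      have "t i \<le> t j" using that t(1) by (simp add: strict_mono_less_eq)
      then show "e (r (t i)) \<le> e (r (t j))" by (rule monoD[OF r(2)])
    qed
    show "g (r (t i)) divides g (r (t j))" by (rule t(2)[OF that])
    show "g (r (t i)) \<in> carrier G" using g H(1) by blast
  qed (use s in simp)
  moreover have "strict_mono (r \<circ> t)" using r(1) t(1) by (rule strict_mono_o)
  ultimately show "\<exists>r :: nat \<Rightarrow> nat. strict_mono r \<and> (\<forall>i j. i \<le> j \<longrightarrow> f (r i) divides f (r j))"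
    by (intro exI[of _ "r \<circ> t"]) simp
qed

lemma submonoid_powers_mult:
  assumes s: "s \<in> carrier G" and H: "submonoid H G"
  shows "submonoid {s [^] (n :: nat) \<otimes> h | n h. h \<in> H} G"
proof -
  interpret H: submonoid H G by (rule H)
  show ?thesis
  proof
    show "{s [^] (n :: nat) \<otimes> h | n h. h \<in> H} \<subseteq> carrier G"
      using s H.subset by auto
    have "\<one> = s [^] (0 :: nat) \<otimes> \<one>" by simp
    then show "\<one> \<in> {s [^] (n :: nat) \<otimes> h | n h. h \<in> H}"
      using H.one_closed by blast
  next
    fix x y
    assume "x \<in> {s [^] (n :: nat) \<otimes> h | n h. h \<in> H}" "y \<in> {s [^] (n :: nat) \<otimes> h | n h. h \<in> H}"
    then obtain m n :: nat and h k where hk: "h \<in> H" "k \<in> H"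
      and xy: "x = s [^] m \<otimes> h" "y = s [^] n \<otimes> k"
      by blast
    have "h \<in> carrier G" "k \<in> carrier G" using hk H.subset by auto
    then have "x \<otimes> y = s [^] (m + n) \<otimes> (h \<otimes> k)"
      unfolding xy using s by (simp add: nat_pow_mult[symmetric] m_ac)
    then show "x \<otimes> y \<in> {s [^] (n :: nat) \<otimes> h | n h. h \<in> H}"
      using H.m_closed[OF hk] by blast
  qed
qed

text \<open>
  Dickson's lemma: adjoining a generator \<open>s\<close> to a submonoid \<open>H\<close> gives the products of powers of \<open>s\<close>
  with elements of \<open>H\<close>, and powers of \<open>s\<close> are compared through their exponents.
\<close>

lemma finite_subset_wqo_submonoid:
  assumes "finite S" "S \<subseteq> carrier G"
  shows "\<exists>H. submonoid H G \<and> S \<subseteq> H \<and> divides_wqo G H"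
  using assms
proof (induction S)
  case empty
  have "submonoid {\<one>} G" by unfold_locales auto
  moreover have "divides_wqo G {\<one>}"
    unfolding divides_wqo_def
  proof (intro allI impI)
    fix f :: "nat \<Rightarrow> 'a" assume "range f \<subseteq> {\<one>}"
    then have "f i = \<one>" for i by auto
    then show "\<exists>r :: nat \<Rightarrow> nat. strict_mono r \<and> (\<forall>i j. i \<le> j \<longrightarrow> f (r i) divides f (r j))"
      by (intro exI[of _ id]) (simp add: strict_mono_def)
  qed
  ultimately show ?case by blast
next
  case (insert s S)
  then obtain H where H: "submonoid H G" "S \<subseteq> H" "divides_wqo G H" by blast
  interpret H: submonoid H G by (rule H)
  have s: "s \<in> carrier G" using insert.prems by simp
  let ?K = "{s [^] (n :: nat) \<otimes> h | n h. h \<in> H}"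
  have "s = s [^] (1 :: nat) \<otimes> \<one>" using s by simp
  then have "s \<in> ?K" using H.one_closed by blast
  moreover have "S \<subseteq> ?K"
  proof
    fix x assume "x \<in> S"
    then have "x \<in> H" using H(2) by blast
    moreover have "x = s [^] (0 :: nat) \<otimes> x" using \<open>x \<in> H\<close> H.subset by auto
    ultimately show "x \<in> ?K" by blast
  qed
  ultimately show ?case
    using submonoid_powers_mult[OF s H(1)] divides_wqo_powers_mult[OF s H.subset H(3)]
    by (intro exI[of _ ?K]) simp
qed

lemma finitely_generated_divides_wqo:
  assumes "finitely_generated_monoid G"
  shows "divides_wqo G (carrier G)"
proof -
  obtain S where S: "finite S" "S \<subseteq> carrier G"
    and gen: "\<forall>H. submonoid H G \<and> S \<subseteq> H \<longrightarrow> H = carrier G"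
    using assms unfolding finitely_generated_monoid_def by (elim exE conjE)
  obtain H where "submonoid H G" "S \<subseteq> H" "divides_wqo G H"
    using finite_subset_wqo_submonoid[OF S] by blast
  moreover from this have "H = carrier G" using gen by simp
  ultimately show ?thesis by simp
qed

text \<open>
  In a strictly descending chain no term divides a later one, whereas the well-quasi-order provides
  such a pair.
\<close>

lemma wf_properfactor:
  assumes "finitely_generated_monoid G"
  shows "wf {(x, y). x \<in> carrier G \<and> y \<in> carrier G \<and> properfactor G x y}"
proof (unfold wf_iff_no_infinite_down_chain, rule notI, elim exE)
  fix f :: "nat \<Rightarrow> 'a"
  assume "\<forall>i. (f (Suc i), f i) \<in> {(x, y). x \<in> carrier G \<and> y \<in> carrier G \<and> properfactor G x y}"
  then have carr: "\<And>i. f i \<in> carrier G" and chain: "\<And>i. properfactor G (f (Suc i)) (f i)"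
    by auto
  have desc: "f j divides f i" if "i \<le> j" for i j
    using that
  proof (induction rule: dec_induct)
    case base
    then show ?case using carr by simp
  next
    case (step n)
    have "f (Suc n) divides f n"
      using chain[of n] unfolding properfactor_def by blast
    then show ?case using step.IH carr by (rule divides_trans)
  qed
  have "range f \<subseteq> carrier G" using carr by auto
  then obtain r :: "nat \<Rightarrow> nat"
    where r: "strict_mono r" "\<And>i j. i \<le> j \<Longrightarrow> f (r i) divides f (r j)"
    using finitely_generated_divides_wqo[OF assms] unfolding divides_wqo_def by blast
  have "r 0 < r 1" using r(1) by (simp add: strict_mono_def)
  then have "f (r 1) divides f (Suc (r 0))" using desc by simp
  then have "f (r 0) divides f (Suc (r 0))"
    using r(2)[of 0 1] carr divides_trans[of "f (r 0)" "f (r 1)"] by simp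
  then show False using chain[of "r 0"] unfolding properfactor_def by simp
qed

end

section \<open>Cancellation\<close>

text \<open>
  The two finiteness conditions sit on different sides: refinement and the well-founded descent take
  place in \<open>D\<close>, and stable finiteness is available only in \<open>N\<close>. The image of \<open>D\<close> in \<open>N\<close> need not
  have refinement, so the induction keeps the elements in \<open>D\<close> and compares their images.
\<close>

lemma refinement_hom_cancel:
  fixes D :: "('b, 'n) monoid_scheme" and N :: "('a, 'm) monoid_scheme"
  assumes D: "refinement_monoid D" "finitely_generated_monoid D"
    and N: "comm_monoid N" "stably_finite_monoid N"
    and h: "h \<in> monoid_homs D N"
    and abc: "a \<in> carrier D" "b \<in> carrier D" "c \<in> carrier D"
    and eq: "a \<otimes>\<^bsub>D\<^esub> b = a \<otimes>\<^bsub>D\<^esub> c"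
  shows "h b = h c"
proof -
  interpret D: refinement_monoid D by (rule D)
  interpret N: comm_monoid N by (rule N)
  have h_closed: "h x \<in> carrier N" if "x \<in> carrier D" for x
    using h that by (auto simp: monoid_homs_def hom_def)
  have h_mult: "h (x \<otimes>\<^bsub>D\<^esub> y) = h x \<otimes>\<^bsub>N\<^esub> h y" if "x \<in> carrier D" "y \<in> carrier D" for x y
    using h that by (auto simp: monoid_homs_def hom_def)
  show ?thesis
    using abc eq
  proof (induction a arbitrary: b c rule: wf_induct_rule[OF D.wf_properfactor[OF D(2)]])
    case (1 a b c)
    obtain d p q r where carr: "d \<in> carrier D" "p \<in> carrier D" "q \<in> carrier D" "r \<in> carrier D"
      and a: "a = d \<otimes>\<^bsub>D\<^esub> p" "a = d \<otimes>\<^bsub>D\<^esub> q"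
      and b: "b = q \<otimes>\<^bsub>D\<^esub> r" and c: "c = p \<otimes>\<^bsub>D\<^esub> r"
      using D.refinement[of a b a c] 1(2-5) by blast
    have "h p = h q"
    proof (cases "a divides\<^bsub>D\<^esub> d")
      case True
      then obtain s where s: "s \<in> carrier D" "d = a \<otimes>\<^bsub>D\<^esub> s" unfolding factor_def by blast
      \<comment> \<open>Here \<open>a\<close> absorbs both \<open>s \<otimes> p\<close> and \<open>s \<otimes> q\<close>, so stable finiteness makes \<open>h p\<close> and \<open>h q\<close>
        inverses of \<open>h s\<close>.\<close>
      have inv: "h s \<otimes>\<^bsub>N\<^esub> h x = \<one>\<^bsub>N\<^esub>" if x: "x \<in> carrier D" "a = d \<otimes>\<^bsub>D\<^esub> x" for x
      proof -
        have "a = a \<otimes>\<^bsub>D\<^esub> (s \<otimes>\<^bsub>D\<^esub> x)"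
          using x s 1(2) by (metis D.m_assoc)
        then have "h a \<otimes>\<^bsub>N\<^esub> (h s \<otimes>\<^bsub>N\<^esub> h x) = h a"
          using h_mult x(1) s(1) 1(2) by (metis D.m_closed)
        moreover have "h a \<in> carrier N" "h s \<otimes>\<^bsub>N\<^esub> h x \<in> carrier N"
          using h_closed x(1) s(1) 1(2) by auto
        ultimately show ?thesis using N(2) unfolding stably_finite_monoid_def by blast
      qed
      have "h p \<otimes>\<^bsub>N\<^esub> h s = \<one>\<^bsub>N\<^esub>" "h s \<otimes>\<^bsub>N\<^esub> h q = \<one>\<^bsub>N\<^esub>"
        using inv a carr s(1) h_closed N.m_comm by auto
      then show ?thesis using N.inv_unique h_closed carr s(1) by blast
    next
      case False
      have "properfactor D d a"
        using False a(1) carr unfolding properfactor_def factor_def by blast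
      moreover have "d \<otimes>\<^bsub>D\<^esub> p = d \<otimes>\<^bsub>D\<^esub> q" using a by simp
      ultimately show ?thesis using 1(1)[of d p q] 1(2) carr by simp
    qed
    then show ?case unfolding b c using h_mult carr by simp
  qed
qed

text \<open>
  Equality in the limit is equality at some stage, so a failure of cancellation can be pulled back to
  one of the finitely generated monoids, whose map to the limit is governed by
  \<open>refinement_hom_cancel\<close>.
\<close>

lemma (in inductive_system) cancellative_inductive_limit:
  assumes D: "\<And>i. i \<in> I \<Longrightarrow> refinement_monoid (D i)"
      "\<And>i. i \<in> I \<Longrightarrow> finitely_generated_monoid (D i)"
    and sf: "stably_finite_monoid inductive_limit"
  shows "cancellative_monoid inductive_limit"
  unfolding cancellative_monoid_def
proof (intro ballI impI)
  interpret L: comm_monoid inductive_limit by (rule comm_monoid_inductive_limit)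
  fix X Y Z
  assume X: "X \<in> carrier inductive_limit" and Y: "Y \<in> carrier inductive_limit"
    and Z: "Z \<in> carrier inductive_limit"
    and eq: "X \<otimes>\<^bsub>inductive_limit\<^esub> Y = X \<otimes>\<^bsub>inductive_limit\<^esub> Z"
  obtain i x y where i: "i \<in> I" "x \<in> carrier (D i)" "y \<in> carrier (D i)"
      "X = lim_map i x" "Y = lim_map i y"
    using lim_common[OF X Y] by blast
  obtain j x' z where j: "j \<in> I" "x' \<in> carrier (D j)" "z \<in> carrier (D j)"
      "X = lim_map j x'" "Z = lim_map j z"
    using lim_common[OF X Z] by blast
  have "lim_map i (x \<otimes>\<^bsub>D i\<^esub> y) = lim_map j (x' \<otimes>\<^bsub>D j\<^esub> z)"
    using eq i(4,5) j(4,5) lim_mult_same[OF i(1-3)] lim_mult_same[OF j(1-3)] by metis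
  then obtain k where k: "k \<in> I" "le i k" "le j k"
      "\<phi> i k (x \<otimes>\<^bsub>D i\<^esub> y) = \<phi> j k (x' \<otimes>\<^bsub>D j\<^esub> z)"
    using lim_map_eq_iff i j D_mult_closed by metis
  obtain l where l: "l \<in> I" "le i l" "le j l" "\<phi> i l x = \<phi> j l x'"
    using lim_map_eq_iff[of i j x x'] i j by auto
  obtain m where m: "m \<in> I" "le k m" "le l m" using directed k(1) l(1) by blast
  have le: "le i m" "le j m" using i j k m le_trans by blast+
  have x_eq: "\<phi> i m x = \<phi> j m x'"
    using i j l m \<phi>_comp by metis
  have "\<phi> i m (x \<otimes>\<^bsub>D i\<^esub> y) = \<phi> j m (x' \<otimes>\<^bsub>D j\<^esub> z)"
    using i j k m \<phi>_comp D_mult_closed by metis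
  then have "\<phi> i m x \<otimes>\<^bsub>D m\<^esub> \<phi> i m y = \<phi> i m x \<otimes>\<^bsub>D m\<^esub> \<phi> j m z"
    using i j m le x_eq by (simp add: \<phi>_mult)
  then have "lim_map m (\<phi> i m y) = lim_map m (\<phi> j m z)"
    using i j m le
    by (intro refinement_hom_cancel[OF D(1,2) L.comm_monoid_axioms sf lim_map_hom,
          where a = "\<phi> i m x"])
       (auto intro: \<phi>_closed)
  then show "Y = Z" using i j m le by (simp add: lim_map_compat)
qed

text \<open>
  Membership in \<open>iso\<close> only says that \<open>f\<close> is bijective and respects products. But an equation
  \<open>X \<otimes> Y = X\<close> in \<open>N\<close> pulls back to \<open>M\<close>, so stable finiteness forces \<open>Y = f \<one>\<close>. Applied to the unit
  of \<open>N\<close> in the place of \<open>Y\<close>, this shows that \<open>f \<one>\<close> is that unit.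
\<close>

lemma stably_finite_monoid_iso:
  assumes f: "f \<in> iso M N" and M: "monoid M" and N: "monoid N" and sf: "stably_finite_monoid M"
  shows "stably_finite_monoid N"
proof -
  interpret M: monoid M by (rule M)
  interpret N: monoid N by (rule N)
  have hom: "f \<in> hom M N" and inj: "inj_on f (carrier M)"
    using f unfolding iso_iff by auto
  have surj: "\<exists>x \<in> carrier M. X = f x" if "X \<in> carrier N" for X
    using f that unfolding iso_iff by blast
  have absorbed: "Y = f \<one>\<^bsub>M\<^esub>"
    if XY: "X \<in> carrier N" "Y \<in> carrier N" "X \<otimes>\<^bsub>N\<^esub> Y = X" for X Y
  proof -
    obtain x y where x: "x \<in> carrier M" "X = f x" and y: "y \<in> carrier M" "Y = f y"
      using surj XY(1,2) by blast
    have "f (x \<otimes>\<^bsub>M\<^esub> y) = f x"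
      using XY(3) x y hom_mult[OF hom x(1) y(1)] by simp
    then have "x \<otimes>\<^bsub>M\<^esub> y = x"
      using inj x(1) y(1) by (simp add: inj_on_eq_iff)
    then show ?thesis using sf x(1) y unfolding stably_finite_monoid_def by blast
  qed
  have "\<one>\<^bsub>N\<^esub> = f \<one>\<^bsub>M\<^esub>" by (rule absorbed[of "\<one>\<^bsub>N\<^esub>"]) simp_all
  then show ?thesis using absorbed unfolding stably_finite_monoid_def by metis
qed

lemma cancellative_monoid_iso:
  assumes f: "f \<in> iso M N" and "cancellative_monoid N"
  shows "cancellative_monoid M"
  unfolding cancellative_monoid_def
proof (intro ballI impI)
  fix x y z
  assume xyz: "x \<in> carrier M" "y \<in> carrier M" "z \<in> carrier M"
    and eq: "x \<otimes>\<^bsub>M\<^esub> y = x \<otimes>\<^bsub>M\<^esub> z"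
  have hom: "f \<in> hom M N" and inj: "inj_on f (carrier M)"
    using f unfolding iso_iff by auto
  have "f x \<otimes>\<^bsub>N\<^esub> f y = f x \<otimes>\<^bsub>N\<^esub> f z"
    using eq xyz hom by (metis hom_mult)
  then have "f y = f z"
    using assms(2) xyz hom unfolding cancellative_monoid_def by (meson hom_in_carrier)
  then show "y = z" using inj xyz by (simp add: inj_on_eq_iff)
qed

theorem theorem2p12:
  fixes M :: "('a, 'm) monoid_scheme"
  assumes "tame_refinement_monoid TYPE('i) TYPE('b) M"
    and "stably_finite_monoid M"
  shows "cancellative_monoid M"
proof -
  interpret M: refinement_monoid M using assms(1) by (simp add: tame_refinement_monoid_def)
  obtain I :: "'i set" and le and D :: "'i \<Rightarrow> 'b monoid" and \<phi>
    where sys: "inductive_system I le D \<phi>"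
      and D: "\<And>i. i \<in> I \<Longrightarrow> refinement_monoid (D i) \<and> finitely_generated_monoid (D i)"
      and iso: "M \<cong> inductive_system.inductive_limit I le D \<phi>"
    using assms(1) unfolding tame_refinement_monoid_def by blast
  interpret inductive_system I le D \<phi> by (rule sys)
  interpret L: comm_monoid inductive_limit by (rule comm_monoid_inductive_limit)
  obtain f where f: "f \<in> iso M inductive_limit" using iso unfolding is_iso_def by blast
  have "stably_finite_monoid inductive_limit"
    by (rule stably_finite_monoid_iso[OF f M.monoid_axioms L.monoid_axioms assms(2)])
  then have "cancellative_monoid inductive_limit"
    using D by (intro cancellative_inductive_limit) auto
  then show ?thesis by (rule cancellative_monoid_iso[OF f])
qed

end
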